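(* Let $I,J$ be finite sets, let $A\in\mathbb{R}^{J\times I}$ have columns $f_i$ ($i\in I$), and let $\mathcal{E}_A=\{p_\theta:\theta\in\mathbb{R}^J\}$ be the corresponding discrete exponential family. Let $n=(n(i))_{i\in I}$ be a nonzero vector of observed counts with support $I_+=\{i\in I:n(i)>0\}$, let $F_t\subseteq I$ be the smallest facial set containing $I_+$, and let $p^*$ be the extended maximum likelihood estimate for $n$. Choose an element of $I_+$, denoted $0$, and let $L_t\subseteq F_t$ be a maximal subset of $F_t$ such that the parameters $\mu_i(\theta)=\langle\theta,f_i-f_0\rangle$, $i\in L_t$, are linearly independent (as linear functions of $\theta$). Suppose that $\theta^{(s)}\in\mathbb{R}^J$, $s\in\mathbb{N}$, are parameter values such that $p_{\theta^{(s)}}\to p^*$ as $s\to\infty$. Then: (a) For any $i\in L_t$, the linear combination $\mu_i^{(s)}=\langle\theta^{(s)},f_i-f_0\rangle$ has a well-defined finite limit as $s\to\infty$. (b) Any linear combination of the components of $\theta^{(s)}$ that has a well-defined finite limit is a linear combination of the $\mu_i^{(s)}$ with $i\in L_t$. That is, if $c\in\mathbb{R}^J$ is such that $\lim_{s\to\infty}\langle c,\theta^{(s)}\rangle$ exists, is finite, and has the same value for all sequences $\theta^{(s)}$ with $p_{\theta^{(s)}}\to p^*$, then there are real numbers $b_i$, $i\in L_t$, with $\langle c,\theta\rangle=\sum_{i\in L_t}b_i\langle\theta,f_i-f_0\rangle$ for all $\theta\in\mathbb{R}^J$.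
   Context: For $\theta\in\mathbb{R}^J$, $p_\theta(i)=\exp(\langle\theta,f_i\rangle-k(\theta))$ with $k(\theta)=\log\sum_{i\in I}\exp\langle\theta,f_i\rangle$, a probability distribution on $I$. The convex support polytope $\mathbf{P}_A$ is the convex hull of $\{f_i:i\in I\}$. A subset $F\subseteq I$ is facial if $F=\{i\in I:f_i\in\mathbf{F}\}$ for some face $\mathbf{F}$ of $\mathbf{P}_A$ (including $\mathbf{P}_A$ itself); every subset of $I$ is contained in a smallest facial set. With $N=\sum_i n(i)$ and $t=An$, $F_t$ is the facial set of the smallest face of $\mathbf{P}_A$ containing $t/N$, equivalently the smallest facial set containing $I_+$. The extended maximum likelihood estimate $p^*$ is the unique maximizer of $\tilde l(p)=\log\prod_{i\in I}p(i)^{n(i)}$ over the topological closure $\overline{\mathcal{E}_A}$ of $\mathcal{E}_A$. It is a known fact (Barndorff-Nielsen) that it exists, is unique, satisfies $Ap^*=t/N$, and has support exactly $F_t$; moreover $p^*$ lies in $\mathcal{E}_{F_t,A}$, the set of distributions that vanish off $F_t$ and are of the form $\exp(\langle\theta,f_i\rangle-k_{F_t}(\theta))$ for $i\in F_t$, where $k_{F_t}(\theta)=\log\sum_{i\in F_t}\exp\langle\theta,f_i\rangle$. A linear combination of parameters has a "well-defined" limit if the limit does not depend on the choice of the sequence $\theta^{(s)}$ with $p_{\theta^{(s)}}\to p^*$. *)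

theory Defs
  imports "HOL-Analysis.Analysis"
begin

text \<open>The rows of the design matrix \<open>A\<close> are indexed by \<open>'j\<close> and its columns \<open>f\<^sub>i\<close> by \<open>'i\<close>;
  \<open>f\<^sub>i\<close> is \<^term>\<open>column i A\<close>.\<close>

definition log_partition :: "real ^ 'i ^ 'j \<Rightarrow> real ^ 'j \<Rightarrow> real" where
  "log_partition A \<theta> = ln (\<Sum>i\<in>UNIV. exp (\<theta> \<bullet> column i A))"

definition p_theta :: "real ^ 'i ^ 'j \<Rightarrow> real ^ 'j \<Rightarrow> real ^ 'i" where
  "p_theta A \<theta> = (\<chi> i. exp (\<theta> \<bullet> column i A - log_partition A \<theta>))"

definition exp_family :: "real ^ 'i ^ 'j \<Rightarrow> (real ^ 'i) set" where
  "exp_family A = range (p_theta A)"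

definition support_polytope :: "real ^ 'i ^ 'j \<Rightarrow> (real ^ 'j) set" where
  "support_polytope A = convex hull (range (\<lambda>i. column i A))"

definition facial :: "real ^ 'i ^ 'j \<Rightarrow> 'i set \<Rightarrow> bool" where
  "facial A F \<longleftrightarrow> (\<exists>\<FF>. \<FF> face_of support_polytope A \<and> F = {i. column i A \<in> \<FF>})"

definition smallest_facial :: "real ^ 'i ^ 'j \<Rightarrow> 'i set \<Rightarrow> 'i set \<Rightarrow> bool" where
  "smallest_facial A S F \<longleftrightarrow>
     facial A F \<and> S \<subseteq> F \<and> (\<forall>G. facial A G \<and> S \<subseteq> G \<longrightarrow> F \<subseteq> G)"

definition observed :: "nat ^ 'i \<Rightarrow> 'i set" where
  "observed n = {i. n $ i > 0}"

text \<open>The logarithm takes the value \<open>-\<infinity>\<close> at \<open>0\<close>, whereas \<^term>\<open>ln (0::real)\<close> is \<open>0\<close>;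
  hence the extended reals. Cells with \<open>n(i) = 0\<close> contribute a factor \<open>p(i)\<^sup>0 = 1\<close>, also where
  \<open>p(i) = 0\<close>.\<close>

definition log_likelihood :: "nat ^ 'i \<Rightarrow> real ^ 'i \<Rightarrow> ereal" where
  "log_likelihood n p =
     (let l = (\<Prod>i\<in>UNIV. (p $ i) ^ (n $ i)) in if l = 0 then -\<infinity> else ereal (ln l))"

definition is_EMLE :: "real ^ 'i ^ 'j \<Rightarrow> nat ^ 'i \<Rightarrow> real ^ 'i \<Rightarrow> bool" where
  "is_EMLE A n p \<longleftrightarrow> is_arg_max (log_likelihood n) (\<lambda>q. q \<in> closure (exp_family A)) p"

definition mu :: "real ^ 'i ^ 'j \<Rightarrow> 'i \<Rightarrow> 'i \<Rightarrow> real ^ 'j \<Rightarrow> real" where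
  "mu A i0 i \<theta> = \<theta> \<bullet> (column i A - column i0 A)"

text \<open>Independence of a family: two indices with the same parameter are dependent.\<close>

definition lin_indep_params :: "('i \<Rightarrow> real ^ 'j \<Rightarrow> real) \<Rightarrow> ('i::finite) set \<Rightarrow> bool" where
  "lin_indep_params g L \<longleftrightarrow>
     (\<forall>b. (\<forall>\<theta>. (\<Sum>i\<in>L. b i * g i \<theta>) = 0) \<longrightarrow> (\<forall>i\<in>L. b i = 0))"

definition maximal_indep_params :: "('i \<Rightarrow> real ^ 'j \<Rightarrow> real) \<Rightarrow> ('i::finite) set \<Rightarrow> 'i set \<Rightarrow> bool" where
  "maximal_indep_params g F L \<longleftrightarrow>
     L \<subseteq> F \<and> lin_indep_params g L \<and>
     (\<forall>L'. L \<subseteq> L' \<and> L' \<subseteq> F \<and> lin_indep_params g L' \<longrightarrow> L' = L)"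

text \<open>The same limit \<open>l\<close> along every sequence of parameters whose distributions tend to \<open>p\<close>.\<close>

definition well_defined_limit ::
    "real ^ 'i ^ 'j \<Rightarrow> real ^ 'i \<Rightarrow> (real ^ 'j \<Rightarrow> real) \<Rightarrow> real \<Rightarrow> bool" where
  "well_defined_limit A p g l \<longleftrightarrow>
     (\<forall>\<theta> :: nat \<Rightarrow> real ^ 'j. (\<lambda>s. p_theta A (\<theta> s)) \<longlonglongrightarrow> p \<longrightarrow> (\<lambda>s. g (\<theta> s)) \<longlonglongrightarrow> l)"

end

theory Submission
  imports Defs
begin

text \<open>
  Everything rests on the support of an extended maximum likelihood estimate \<open>p\<close> being exactly
  \<open>F\<^sub>t\<close>.

  The support contains the observed cells, since the uniform distribution is in the family and
  has positive likelihood. It then contains all of \<open>F\<^sub>t\<close>: the barycentre \<open>x\<close> of the observed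
  columns lies in the relative interior of the face belonging to \<open>F\<^sub>t\<close>, so for every \<open>i \<in> F\<^sub>t\<close>
  the segment from \<open>f\<^sub>i\<close> to \<open>x\<close> can be prolonged a little inside the polytope. This bounds
  \<open>ln p\<^sub>\<theta>(i)\<close> below by a multiple of \<open>\<Sum>\<^sub>j ln p\<^sub>\<theta>(j)\<close>, \<open>j\<close> observed, uniformly in \<open>\<theta>\<close>, so no mass
  inside \<open>F\<^sub>t\<close> vanishes in a limit that keeps the observed cells
  (\<open>limit_pos_on_smallest_facial\<close>). Conversely, mass outside \<open>F\<^sub>t\<close> is wasteful: translating \<open>\<theta>\<close>
  by the normal \<open>v\<close> of a supporting hyperplane that cuts out the face reweights the cells by
  \<open>exp \<langle>v, f\<^sub>i\<rangle>\<close>, which acts on the closure of the family and would strictly raise the probability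
  of all observed cells if there were such mass (\<open>EMLE_zero_outside_facial\<close>).

  Given the support, (a) holds because \<open>\<mu>\<^sub>i = ln (p\<^sub>\<theta>(i) / p\<^sub>\<theta>(0))\<close> is a continuous function of the
  distribution where both cells are positive. For (b), translating the parameters by a vector \<open>v\<close>
  orthogonal to all \<open>f\<^sub>i - f\<^sub>0\<close>, \<open>i \<in> F\<^sub>t\<close>, rescales all cells of \<open>F\<^sub>t\<close> by the same factor, hence
  does not move the limit \<open>p\<close>. A well-defined limit of \<open>\<langle>c, \<theta>\<rangle>\<close> therefore forces \<open>\<langle>c, v\<rangle> = 0\<close> for
  all such \<open>v\<close>, that is, \<open>c\<close> lies in the span of the \<open>f\<^sub>i - f\<^sub>0\<close>, \<open>i \<in> F\<^sub>t\<close>; by maximality \<open>L\<^sub>t\<close>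
  already spans this space.
\<close>

section \<open>The exponential family\<close>

lemma partition_pos: "(\<Sum>i\<in>UNIV. exp (\<theta> \<bullet> column (i::'i::finite) A)) > 0"
  by (intro sum_pos) auto

lemma p_theta_eq:
  "p_theta A \<theta> $ i = exp (\<theta> \<bullet> column i A) / (\<Sum>j\<in>UNIV. exp (\<theta> \<bullet> column j A))"
  using partition_pos[of \<theta> A] by (simp add: p_theta_def log_partition_def exp_diff)

lemma p_theta_pos: "p_theta A \<theta> $ i > 0"
  by (simp add: p_theta_def)

lemma ln_p_theta: "ln (p_theta A \<theta> $ i) = \<theta> \<bullet> column i A - log_partition A \<theta>"
  by (simp add: p_theta_def)

lemma sum_p_theta: "(\<Sum>i\<in>UNIV. p_theta A \<theta> $ i) = 1"
  using partition_pos[of \<theta> A] by (simp add: p_theta_eq flip: sum_divide_distrib)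

lemma mu_eq_ln_ratio: "mu A i0 i \<theta> = ln (p_theta A \<theta> $ i / p_theta A \<theta> $ i0)"
  by (simp add: mu_def ln_div order_less_imp_not_eq2[OF p_theta_pos] ln_p_theta inner_diff_right)

lemma inner_le_log_partition:
  assumes "y \<in> support_polytope A"
  shows "\<theta> \<bullet> y \<le> log_partition A \<theta>"
proof -
  have "\<theta> \<bullet> column i A \<le> log_partition A \<theta>" for i
  proof -
    have "p_theta A \<theta> $ i \<le> (\<Sum>j\<in>UNIV. p_theta A \<theta> $ j)"
      by (intro member_le_sum) (auto intro: less_imp_le[OF p_theta_pos])
    then show ?thesis by (simp add: sum_p_theta, simp add: p_theta_def)
  qed
  then have "support_polytope A \<subseteq> {y. \<theta> \<bullet> y \<le> log_partition A \<theta>}"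
    unfolding support_polytope_def
    by (intro hull_minimal) (auto simp: convex_halfspace_le)
  with assms show ?thesis by blast
qed

lemma limit_nonneg:
  assumes "(\<lambda>s. p_theta A (\<theta> s)) \<longlonglongrightarrow> p"
  shows "p $ i \<ge> 0"
  using tendsto_vec_nth[OF assms, of i]
  by (rule LIMSEQ_le_const) (auto intro: less_imp_le[OF p_theta_pos])

lemma limit_sum:
  assumes "(\<lambda>s. p_theta A (\<theta> s)) \<longlonglongrightarrow> p"
  shows "(\<Sum>i\<in>UNIV. p $ i) = 1"
proof -
  have "(\<lambda>s. \<Sum>i\<in>UNIV. p_theta A (\<theta> s) $ i) \<longlonglongrightarrow> (\<Sum>i\<in>UNIV. p $ i)"
    by (intro tendsto_intros assms)
  then show ?thesis by (simp add: sum_p_theta LIMSEQ_const_iff)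
qed

section \<open>Translating the parameters\<close>

text \<open>The action of the translation by \<open>v\<close> on distributions. Unlike the translation itself it makes
  sense on the whole closure of the family, where there may be no parameters left.\<close>

definition tilt :: "real ^ 'i ^ 'j \<Rightarrow> real ^ 'j \<Rightarrow> real ^ 'i \<Rightarrow> real ^ 'i" where
  "tilt A v p =
     (\<chi> i. p $ i * exp (v \<bullet> column i A) / (\<Sum>j\<in>UNIV. p $ j * exp (v \<bullet> column j A)))"

lemma p_theta_add: "p_theta A (\<theta> + v) = tilt A v (p_theta A \<theta>)"
  using partition_pos[of \<theta> A]
  by (simp add: vec_eq_iff tilt_def p_theta_eq inner_add_left exp_add
      flip: sum_divide_distrib)

lemma tilt_norm_pos:
  assumes "\<And>i. p $ i \<ge> 0" "(\<Sum>i\<in>UNIV. p $ i) = 1"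
  shows "(\<Sum>j\<in>UNIV. p $ j * exp (v \<bullet> column j A)) > 0"
proof -
  obtain k where "p $ k \<noteq> 0"
    using assms(2) by (metis sum.neutral zero_neq_one)
  with assms(1)[of k] have "p $ k > 0" by simp
  then show ?thesis
    by (intro sum_pos2[of _ k]) (auto simp: assms(1))
qed

lemma tendsto_p_theta_add:
  assumes lim: "(\<lambda>s. p_theta A (\<theta> s)) \<longlonglongrightarrow> p"
  shows "(\<lambda>s. p_theta A (\<theta> s + v)) \<longlonglongrightarrow> tilt A v p"
  unfolding p_theta_add tilt_def
  using tilt_norm_pos[OF limit_nonneg[OF lim] limit_sum[OF lim], of v A]
  by (intro vec_tendstoI) (auto intro!: tendsto_intros lim)

text \<open>Only the cells that carry mass matter: the common factor cancels against the norming
  constant.\<close>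

lemma tilt_eq_self:
  assumes "(\<Sum>i\<in>UNIV. p $ i) = 1" and "\<And>i. p $ i \<noteq> 0 \<Longrightarrow> v \<bullet> column i A = r"
  shows "tilt A v p = p"
proof -
  have *: "p $ i * exp (v \<bullet> column i A) = p $ i * exp r" for i
    using assms(2)[of i] by (cases "p $ i = 0") auto
  show ?thesis
    unfolding tilt_def * by (simp add: vec_eq_iff assms(1) flip: sum_distrib_right)
qed

section \<open>The support of an extended maximum likelihood estimate\<close>

text \<open>Were the barycentre \<open>x\<close> on the relative boundary, a hyperplane through \<open>x\<close> would support the
  face without containing it. Since \<open>x\<close> is a positive combination of the columns in \<open>S\<close>, these
  would lie on the hyperplane, which would cut out a smaller facial set containing \<open>S\<close>.\<close>

lemma barycentre_in_rel_interior:
  assumes sm: "smallest_facial A S F" and "S \<noteq> {}"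
    and face: "\<FF> face_of support_polytope A" and F: "F = {i. column i A \<in> \<FF>}"
  shows "(\<Sum>j\<in>S. column j A) /\<^sub>R real (card S) \<in> rel_interior \<FF>"
proof (rule ccontr)
  let ?x = "(\<Sum>j\<in>S. column j A) /\<^sub>R real (card S)"
  assume nx: "?x \<notin> rel_interior \<FF>"
  have card: "card S > 0" using \<open>S \<noteq> {}\<close> by (simp add: card_gt_0_iff)
  have SF: "column j A \<in> \<FF>" if "j \<in> S" for j
    using sm F that by (auto simp: smallest_facial_def)
  have conv: "convex \<FF>" using face face_of_imp_convex by blast
  have "(\<Sum>j\<in>S. (1 / real (card S)) *\<^sub>R column j A) \<in> \<FF>"
    using card by (intro convex_sum conv SF) auto
  then have xF: "?x \<in> \<FF>"
    by (simp only: scaleR_sum_right inverse_eq_divide)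
  obtain a where "a \<noteq> 0" and le: "\<And>y. y \<in> \<FF> \<Longrightarrow> a \<bullet> ?x \<le> a \<bullet> y"
    and less: "\<And>y. y \<in> rel_interior \<FF> \<Longrightarrow> a \<bullet> ?x < a \<bullet> y"
    by (rule supporting_hyperplane_rel_boundary[OF conv xF nx]) (rule that)
  let ?G = "\<FF> \<inter> {y. a \<bullet> y = a \<bullet> ?x}"
  have "?G face_of \<FF>"
    by (rule face_of_Int_supporting_hyperplane_ge[OF conv]) (use le in auto)
  then have G: "?G face_of support_polytope A"
    using face face_of_trans by blast
  have "(\<Sum>j\<in>S. a \<bullet> column j A - a \<bullet> ?x) = 0"
    using card by (simp add: sum_subtractf inner_sum_right field_simps)
  then have "\<forall>j\<in>S. a \<bullet> column j A - a \<bullet> ?x = 0"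
    by (subst (asm) sum_nonneg_eq_0_iff) (use le SF in auto)
  then have "S \<subseteq> {i. column i A \<in> ?G}" using SF by auto
  moreover have "facial A {i. column i A \<in> ?G}"
    using G unfolding facial_def by blast
  ultimately have FG: "F \<subseteq> {i. column i A \<in> ?G}"
    using sm unfolding smallest_facial_def by blast
  have "compact (range (\<lambda>i. column i A))" by (simp add: finite_imp_compact)
  then obtain T where T: "T \<subseteq> range (\<lambda>i. column i A)" "\<FF> = convex hull T"
    by (rule face_of_convex_hull_subset[OF _ face[unfolded support_polytope_def]])
  have "T \<subseteq> \<FF>" using T(2) hull_subset by metis
  with T(1) F FG have "T \<subseteq> {y. a \<bullet> y = a \<bullet> ?x}" by fast
  then have eq: "\<FF> \<subseteq> {y. a \<bullet> y = a \<bullet> ?x}"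
    unfolding T(2) by (intro hull_minimal convex_hyperplane) auto
  have "rel_interior \<FF> \<noteq> {}"
    using conv xF rel_interior_eq_empty by blast
  then show False
    using eq less rel_interior_subset by fastforce
qed

text \<open>Prolong the segment from \<open>f\<^sub>i\<close> through the barycentre \<open>x\<close> to a point \<open>y\<close> of the polytope.
  The affine function \<open>z \<mapsto> \<langle>\<theta>, z\<rangle> - k(\<theta>)\<close> equals \<open>ln p\<^sub>\<theta>(i)\<close> at \<open>f\<^sub>i\<close>, the mean of the
  \<open>ln p\<^sub>\<theta>(j)\<close>, \<open>j \<in> S\<close>, at \<open>x\<close>, and is at most \<open>0\<close> at \<open>y\<close>. As \<open>x\<close> divides the segment in a ratio
  independent of \<open>\<theta>\<close>, so is the resulting constant.\<close>

lemma ln_p_theta_lower_bound: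
  assumes sm: "smallest_facial A S F" and "S \<noteq> {}" and "i \<in> F"
  obtains C where "\<And>\<theta>. ln (p_theta A \<theta> $ i) \<ge> C * (\<Sum>j\<in>S. ln (p_theta A \<theta> $ j))"
proof -
  let ?x = "(\<Sum>j\<in>S. column j A) /\<^sub>R real (card S)"
  have card: "card S > 0" using \<open>S \<noteq> {}\<close> by (simp add: card_gt_0_iff)
  obtain \<FF> where face: "\<FF> face_of support_polytope A" and F: "F = {i. column i A \<in> \<FF>}"
    using sm unfolding smallest_facial_def facial_def by blast
  have x: "?x \<in> rel_interior \<FF>"
    by (rule barycentre_in_rel_interior[OF sm \<open>S \<noteq> {}\<close> face F])
  moreover have "convex \<FF>" using face face_of_imp_convex by blast
  ultimately obtain e where e: "e > 1" and y: "(1 - e) *\<^sub>R column i A + e *\<^sub>R ?x \<in> \<FF>"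
    using convex_rel_interior_iff[of \<FF> ?x] \<open>i \<in> F\<close> F by blast
  then have yP: "(1 - e) *\<^sub>R column i A + e *\<^sub>R ?x \<in> support_polytope A"
    using face face_of_imp_subset by blast
  show ?thesis
  proof
    fix \<theta>
    have "(1 - e) * (\<theta> \<bullet> column i A) + e * (\<theta> \<bullet> ?x) \<le> log_partition A \<theta>"
      using inner_le_log_partition[OF yP, of \<theta>] by (simp only: inner_add_right inner_scaleR_right)
    then have "e * (\<theta> \<bullet> ?x - log_partition A \<theta>) \<le> (e - 1) * ln (p_theta A \<theta> $ i)"
      unfolding ln_p_theta by (simp add: algebra_simps)
    moreover have "(\<Sum>j\<in>S. ln (p_theta A \<theta> $ j)) = card S * (\<theta> \<bullet> ?x - log_partition A \<theta>)"
      using card by (simp add: ln_p_theta sum_subtractf inner_sum_right field_simps)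
    ultimately have "(e / card S) * (\<Sum>j\<in>S. ln (p_theta A \<theta> $ j))
        \<le> (e - 1) * ln (p_theta A \<theta> $ i)"
      using card \<open>S \<noteq> {}\<close> by simp
    then have "(e / card S) * (\<Sum>j\<in>S. ln (p_theta A \<theta> $ j)) / (e - 1)
        \<le> ln (p_theta A \<theta> $ i)"
      using e by (subst pos_divide_le_eq) (auto simp only: mult.commute diff_gt_0_iff_gt)
    then show "ln (p_theta A \<theta> $ i)
        \<ge> (e / card S / (e - 1)) * (\<Sum>j\<in>S. ln (p_theta A \<theta> $ j))"
      by (simp only: times_divide_eq_left)
  qed
qed

lemma limit_pos_on_smallest_facial:
  assumes sm: "smallest_facial A S F" and "S \<noteq> {}" and "i \<in> F"
    and lim: "(\<lambda>s. p_theta A (\<theta> s)) \<longlonglongrightarrow> p"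
    and pos: "\<And>j. j \<in> S \<Longrightarrow> p $ j > 0"
  shows "p $ i > 0"
proof -
  obtain C where C: "\<And>\<theta>. ln (p_theta A \<theta> $ i) \<ge> C * (\<Sum>j\<in>S. ln (p_theta A \<theta> $ j))"
    using ln_p_theta_lower_bound[OF assms(1-3)] by blast
  \<comment> \<open>Exponentiated, the bound passes to the limit even if \<open>p $ i\<close> were zero.\<close>
  have "p_theta A (\<theta> s) $ i \<ge> exp (C * (\<Sum>j\<in>S. ln (p_theta A (\<theta> s) $ j)))" for s
    using C[of "\<theta> s"] p_theta_pos[of A "\<theta> s" i] by (simp add: ln_ge_iff)
  moreover have "(\<lambda>s. exp (C * (\<Sum>j\<in>S. ln (p_theta A (\<theta> s) $ j))))
      \<longlonglongrightarrow> exp (C * (\<Sum>j\<in>S. ln (p $ j)))"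
    by (intro tendsto_intros lim) (use pos in force)
  ultimately have "exp (C * (\<Sum>j\<in>S. ln (p $ j))) \<le> p $ i"
    using LIMSEQ_le tendsto_vec_nth[OF lim, of i] by blast
  then show ?thesis
    using exp_gt_zero less_le_trans by blast
qed

lemma is_EMLE_limit:
  assumes "is_EMLE A n p"
  obtains \<theta> where "(\<lambda>s. p_theta A (\<theta> s)) \<longlonglongrightarrow> p"
proof -
  have "p \<in> closure (exp_family A)"
    using assms by (simp add: is_EMLE_def is_arg_max_def)
  then obtain q where q: "\<And>s. q s \<in> exp_family A" "q \<longlonglongrightarrow> p"
    unfolding closure_sequential by blast
  then obtain \<theta> where "q = (\<lambda>s. p_theta A (\<theta> s))"
    unfolding exp_family_def image_iff by metis
  with q(2) that[of \<theta>] show ?thesis by simp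
qed

lemma EMLE_likelihood_maximal:
  assumes "is_EMLE A n p" "(\<lambda>s. p_theta A (\<theta> s)) \<longlonglongrightarrow> q"
  shows "log_likelihood n q \<le> log_likelihood n p"
proof -
  have "q \<in> closure (exp_family A)"
    unfolding closure_sequential exp_family_def
    by (intro exI[of _ "\<lambda>s. p_theta A (\<theta> s)"] conjI allI rangeI assms(2))
  with assms(1) show ?thesis
    by (auto simp: is_EMLE_def is_arg_max_def not_less)
qed

lemma EMLE_pos_on_observed:
  assumes "is_EMLE A n p" "i \<in> observed n"
  shows "p $ i > 0"
proof -
  obtain \<theta> where lim: "(\<lambda>s. p_theta A (\<theta> s)) \<longlonglongrightarrow> p"
    using is_EMLE_limit[OF assms(1)] .
  \<comment> \<open>Any member of the family will do for the comparison.\<close>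
  have "(\<Prod>i\<in>UNIV. (p_theta A 0 $ i) ^ (n $ i)) > 0"
    by (intro prod_pos) (simp add: p_theta_pos)
  then have "log_likelihood n (p_theta A 0) > -\<infinity>"
    by (simp add: log_likelihood_def Let_def del: prod_zero_iff)
  also have "\<dots> \<le> log_likelihood n p"
    by (rule EMLE_likelihood_maximal[OF assms(1), of "\<lambda>_. 0"]) simp
  finally have "(\<Prod>i\<in>UNIV. (p $ i) ^ (n $ i)) \<noteq> 0"
    by (auto simp: log_likelihood_def Let_def simp del: prod_zero_iff)
  then have "p $ i \<noteq> 0"
    using assms(2) by (auto simp: observed_def)
  with limit_nonneg[OF lim, of i] show ?thesis by simp
qed

text \<open>Faces of a polytope are exposed. The tilt along the exposing functional \<open>v\<close> multiplies the
  cells of \<open>F\<close> by \<open>exp b\<close> and the others by less, hence multiplies the observed probabilities by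
  more than \<open>1\<close> as soon as there is mass outside \<open>F\<close>.\<close>

lemma EMLE_zero_outside_facial:
  assumes emle: "is_EMLE A n p" and F: "facial A F" "observed n \<subseteq> F" and "i0 \<in> observed n"
    and "k \<notin> F"
  shows "p $ k = 0"
proof (rule ccontr)
  assume "p $ k \<noteq> 0"
  obtain \<theta> where lim: "(\<lambda>s. p_theta A (\<theta> s)) \<longlonglongrightarrow> p"
    using is_EMLE_limit[OF emle] .
  note nonneg = limit_nonneg[OF lim] and sum1 = limit_sum[OF lim]
  obtain \<FF> where face: "\<FF> face_of support_polytope A" and F_eq: "F = {i. column i A \<in> \<FF>}"
    using F(1) unfolding facial_def by blast
  have "polyhedron (support_polytope A)"
    unfolding support_polytope_def
    by (intro polytope_imp_polyhedron polytope_convex_hull) simp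
  then have "\<FF> exposed_face_of support_polytope A"
    using face exposed_face_of_polyhedron by blast
  then obtain v b where vle: "support_polytope A \<subseteq> {x. v \<bullet> x \<le> b}"
    and veq: "\<FF> = support_polytope A \<inter> {x. v \<bullet> x = b}"
    unfolding exposed_face_of_def by blast
  have colP: "column i A \<in> support_polytope A" for i
    unfolding support_polytope_def by (simp add: hull_inc)
  have le: "v \<bullet> column i A \<le> b" for i using vle colP by blast
  have onF: "v \<bullet> column i A = b" if "i \<in> F" for i using that F_eq veq by blast
  have lt: "v \<bullet> column k A < b"
    using le[of k] \<open>k \<notin> F\<close> F_eq veq colP[of k] by force
  define Z where "Z = (\<Sum>j\<in>UNIV. p $ j * exp (v \<bullet> column j A))"
  have Zpos: "Z > 0" unfolding Z_def by (rule tilt_norm_pos[OF nonneg sum1])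
  have "Z < (\<Sum>j\<in>UNIV. p $ j * exp b)"
    unfolding Z_def
  proof (rule sum_strict_mono_ex1)
    show "\<forall>j\<in>UNIV. p $ j * exp (v \<bullet> column j A) \<le> p $ j * exp b"
      using nonneg le by (auto intro!: mult_left_mono)
    have "p $ k > 0" using \<open>p $ k \<noteq> 0\<close> nonneg[of k] by simp
    with lt show "\<exists>j\<in>UNIV. p $ j * exp (v \<bullet> column j A) < p $ j * exp b"
      by (intro bexI[of _ k]) auto
  qed simp
  then have Zb: "Z < exp b" by (simp add: sum1 flip: sum_distrib_right)
  let ?q = "tilt A v p"
  have pos: "p $ i > 0" if "i \<in> observed n" for i
    using EMLE_pos_on_observed[OF emle that] .
  have q: "?q $ i = p $ i * (exp b / Z)" if "i \<in> observed n" for i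
    using onF[of i] F(2) that by (simp add: tilt_def Z_def subsetD)
  have less: "p $ i < ?q $ i" if "i \<in> observed n" for i
    using pos[OF that] Zb Zpos by (simp add: q[OF that] field_simps)
  have lpos: "(\<Prod>i\<in>UNIV. (p $ i) ^ (n $ i)) > 0"
  proof (intro prod_pos ballI)
    fix i show "0 < p $ i ^ n $ i"
      using pos[of i] by (cases "n $ i = 0") (auto simp: observed_def)
  qed
  have power_le: "p $ i ^ n $ i \<le> ?q $ i ^ n $ i" for i
    using less[of i] nonneg[of i]
    by (cases "n $ i = 0") (auto simp: observed_def intro!: power_mono)
  have "(\<Prod>i\<in>UNIV. (p $ i) ^ (n $ i)) < (\<Prod>i\<in>UNIV. (?q $ i) ^ (n $ i))"
  proof (rule prod_mono_strict)
    show "p $ i0 ^ n $ i0 < ?q $ i0 ^ n $ i0"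
      using less[of i0] nonneg[of i0] \<open>i0 \<in> observed n\<close>
      by (intro power_strict_mono) (auto simp: observed_def)
    show "0 < ?q $ i ^ n $ i" for i
      using less[of i] pos[of i] by (cases "n $ i = 0") (auto simp: observed_def)
  qed (use power_le nonneg in auto)
  with lpos have "log_likelihood n p < log_likelihood n ?q"
    by (simp add: log_likelihood_def Let_def del: prod_zero_iff)
  moreover have "log_likelihood n ?q \<le> log_likelihood n p"
    by (rule EMLE_likelihood_maximal[OF emle tendsto_p_theta_add[OF lim]])
  ultimately show False by simp
qed

section \<open>Maximal independent parameters\<close>

lemma sum_mu: "(\<Sum>i\<in>L. b i * mu A i0 i \<theta>) = (\<Sum>i\<in>L. b i *\<^sub>R (column i A - column i0 A)) \<bullet> \<theta>"
  unfolding inner_sum_left by (simp add: mu_def inner_commute)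

lemma inner_eq_zero_all_iff: "(\<forall>\<theta>. x \<bullet> \<theta> = 0) \<longleftrightarrow> x = 0" for x :: "'a::real_inner"
  using inner_eq_zero_iff[of x] by auto

lemma lin_indep_params_mu:
  "lin_indep_params (mu A i0) L \<longleftrightarrow>
     (\<forall>b. (\<Sum>i\<in>L. b i *\<^sub>R (column i A - column i0 A)) = 0 \<longrightarrow> (\<forall>i\<in>L. b i = 0))"
  by (simp only: lin_indep_params_def sum_mu inner_eq_zero_all_iff)

lemma span_family_sum:
  fixes d :: "'i::finite \<Rightarrow> real ^ 'j"
  assumes "c \<in> span (d ` L)"
  obtains b where "c = (\<Sum>i\<in>L. b i *\<^sub>R d i)"
proof -
  let ?W = "range (\<lambda>b. \<Sum>i\<in>L. b i *\<^sub>R d i)"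
  have "subspace ?W"
    unfolding subspace_def
  proof (intro conjI ballI allI)
    show "0 \<in> ?W" by (rule range_eqI[of _ _ "\<lambda>_. 0"]) simp
    show "x + y \<in> ?W" if xy: "x \<in> ?W" "y \<in> ?W" for x y
    proof -
      obtain b b' where "x = (\<Sum>i\<in>L. b i *\<^sub>R d i)" "y = (\<Sum>i\<in>L. b' i *\<^sub>R d i)"
        using xy by blast
      then show ?thesis
        by (intro range_eqI[of _ _ "\<lambda>i. b i + b' i"]) (simp add: scaleR_left_distrib sum.distrib)
    qed
    show "r *\<^sub>R x \<in> ?W" if x: "x \<in> ?W" for r x
    proof -
      obtain b where "x = (\<Sum>i\<in>L. b i *\<^sub>R d i)" using x by blast
      then show ?thesis
        by (intro range_eqI[of _ _ "\<lambda>i. r * b i"]) (simp add: scaleR_sum_right)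
    qed
  qed
  moreover have "d ` L \<subseteq> ?W"
  proof
    fix x assume "x \<in> d ` L"
    then obtain k where k: "k \<in> L" "x = d k" by blast
    have "(\<Sum>i\<in>L. (if i = k then 1 else 0) *\<^sub>R d i) = (\<Sum>i\<in>L. if i = k then d i else 0)"
      by (intro sum.cong) auto
    with k show "x \<in> ?W"
      by (intro range_eqI[of _ _ "\<lambda>i. if i = k then 1 else 0"]) simp
  qed
  ultimately have "span (d ` L) \<subseteq> ?W" by (rule span_minimal[rotated])
  with assms that show ?thesis by blast
qed

text \<open>Independence is that of an indexed family, so adjoining an index outside \<open>L\<close> produces a
  nontrivial relation even if its column already occurs in \<open>L\<close>; the new coefficient in it cannot
  vanish.\<close>

lemma maximal_indep_params_spans:
  assumes max: "maximal_indep_params (mu A i0) F L" and "i \<in> F"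
  shows "column i A - column i0 A \<in> span ((\<lambda>j. column j A - column i0 A) ` L)"
proof (cases "i \<in> L")
  case True
  then show ?thesis by (simp add: span_base)
next
  case False
  let ?d = "\<lambda>j. column j A - column i0 A"
  have L: "L \<subseteq> F" "lin_indep_params (mu A i0) L"
    using max by (auto simp: maximal_indep_params_def)
  have "insert i L \<noteq> L" using False by blast
  then have "\<not> lin_indep_params (mu A i0) (insert i L)"
    using max \<open>i \<in> F\<close> L(1) unfolding maximal_indep_params_def by blast
  then obtain b k where b: "(\<Sum>j\<in>insert i L. b j *\<^sub>R ?d j) = 0" "k \<in> insert i L" "b k \<noteq> 0"
    unfolding lin_indep_params_mu by blast
  then have sum0: "b i *\<^sub>R ?d i + (\<Sum>j\<in>L. b j *\<^sub>R ?d j) = 0"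
    using False by simp
  have bi: "b i \<noteq> 0"
  proof
    assume "b i = 0"
    with sum0 have "\<forall>j\<in>L. b j = 0"
      using L(2) unfolding lin_indep_params_mu by simp
    with b \<open>b i = 0\<close> show False by blast
  qed
  have "?d i = inverse (b i) *\<^sub>R (b i *\<^sub>R ?d i)" using bi by simp
  also have "b i *\<^sub>R ?d i = - (\<Sum>j\<in>L. b j *\<^sub>R ?d j)"
    using sum0 by (rule eq_neg_iff_add_eq_0[THEN iffD2])
  also have "inverse (b i) *\<^sub>R - (\<Sum>j\<in>L. b j *\<^sub>R ?d j) \<in> span (?d ` L)"
    by (intro span_scale span_neg span_sum) (auto intro: span_base)
  finally show ?thesis .
qed

section \<open>Well-defined limits\<close>

lemma well_defined_limit_mu:
  assumes "p $ i > 0" "p $ i0 > 0"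
  shows "well_defined_limit A p (mu A i0 i) (ln (p $ i / p $ i0))"
  unfolding well_defined_limit_def mu_eq_ln_ratio
  using assms by (auto intro!: tendsto_intros)

text \<open>Translating a sequence by \<open>v\<close> leaves the limit distribution fixed but moves the limit of
  \<open>\<langle>c, \<theta>\<rangle>\<close> by \<open>\<langle>c, v\<rangle>\<close>.\<close>

lemma well_defined_limit_orthogonal:
  assumes wd: "well_defined_limit A p (\<lambda>\<eta>. c \<bullet> \<eta>) l"
    and lim: "(\<lambda>s. p_theta A (\<theta> s)) \<longlonglongrightarrow> p"
    and v: "\<And>i. p $ i \<noteq> 0 \<Longrightarrow> v \<bullet> column i A = r"
  shows "c \<bullet> v = 0"
proof -
  have "(\<lambda>s. p_theta A (\<theta> s + v)) \<longlonglongrightarrow> p"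
    using tendsto_p_theta_add[OF lim, of v] tilt_eq_self[OF limit_sum[OF lim] v] by simp
  with wd have "(\<lambda>s. c \<bullet> (\<theta> s + v)) \<longlonglongrightarrow> l"
    unfolding well_defined_limit_def by (elim allE[of _ "\<lambda>s. \<theta> s + v"] impE)
  moreover from wd lim have "(\<lambda>s. c \<bullet> \<theta> s) \<longlonglongrightarrow> l"
    unfolding well_defined_limit_def by (elim allE[of _ \<theta>] impE)
  ultimately have "(\<lambda>s. c \<bullet> (\<theta> s + v) - c \<bullet> \<theta> s) \<longlonglongrightarrow> l - l"
    by (rule tendsto_diff)
  then show ?thesis by (simp add: inner_add_right LIMSEQ_const_iff)
qed

theorem lemma4p1:
  fixes A :: "real ^ 'i ^ 'j"
    and n :: "nat ^ 'i"
    and Ft Lt :: "'i set"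
    and pstar :: "real ^ 'i"
    and i0 :: 'i
    and \<theta> :: "nat \<Rightarrow> real ^ 'j"
  assumes "n \<noteq> 0"
    and "smallest_facial A (observed n) Ft"
    and "is_EMLE A n pstar"
    and "i0 \<in> observed n"
    and "maximal_indep_params (mu A i0) Ft Lt"
    and "(\<lambda>s. p_theta A (\<theta> s)) \<longlonglongrightarrow> pstar"
  shows "(\<forall>i\<in>Lt. \<exists>l. (\<lambda>s. mu A i0 i (\<theta> s)) \<longlonglongrightarrow> l \<and> well_defined_limit A pstar (mu A i0 i) l)
       \<and> (\<forall>c. (\<exists>l. well_defined_limit A pstar (\<lambda>\<eta>. c \<bullet> \<eta>) l) \<longrightarrow>
              (\<exists>b. \<forall>\<eta>. c \<bullet> \<eta> = (\<Sum>i\<in>Lt. b i * mu A i0 i \<eta>)))"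
proof (intro conjI ballI allI impI)
  note lim = assms(6)
  have Ft: "facial A Ft" "observed n \<subseteq> Ft"
    using assms(2) by (auto simp: smallest_facial_def)
  have pos: "pstar $ i > 0" if "i \<in> Ft" for i
    using limit_pos_on_smallest_facial[OF assms(2) _ that lim] assms(4)
      EMLE_pos_on_observed[OF assms(3)] by blast
  have zero: "pstar $ i = 0" if "i \<notin> Ft" for i
    using EMLE_zero_outside_facial[OF assms(3) Ft assms(4) that] .
  {
    fix i assume "i \<in> Lt"
    then have "i \<in> Ft" using assms(5) by (auto simp: maximal_indep_params_def)
    moreover have "i0 \<in> Ft" using assms(4) Ft(2) by blast
    ultimately have "well_defined_limit A pstar (mu A i0 i) (ln (pstar $ i / pstar $ i0))"
      by (intro well_defined_limit_mu pos)
    with lim show "\<exists>l. (\<lambda>s. mu A i0 i (\<theta> s)) \<longlonglongrightarrow> l \<and> well_defined_limit A pstar (mu A i0 i) l"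
      unfolding well_defined_limit_def by blast
  }
  fix c assume "\<exists>l. well_defined_limit A pstar (\<lambda>\<eta>. c \<bullet> \<eta>) l"
  then obtain l where wd: "well_defined_limit A pstar (\<lambda>\<eta>. c \<bullet> \<eta>) l" by blast
  let ?d = "\<lambda>j. column j A - column i0 A"
  \<comment> \<open>It remains to show that the component \<open>v\<close> of \<open>c\<close> orthogonal to the span vanishes.\<close>
  obtain y v where y: "y \<in> span (?d ` Lt)"
    and v: "\<And>w. w \<in> span (?d ` Lt) \<Longrightarrow> orthogonal v w" and c: "c = y + v"
    using orthogonal_subspace_decomp_exists[of "?d ` Lt" c] by blast
  have "v \<bullet> column i A = v \<bullet> column i0 A" if "pstar $ i \<noteq> 0" for i
  proof -
    have "i \<in> Ft" using zero that by blast
    then have "orthogonal v (?d i)"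
      by (intro v maximal_indep_params_spans[OF assms(5)])
    then show ?thesis by (simp add: orthogonal_def inner_diff_right)
  qed
  then have "c \<bullet> v = 0"
    by (rule well_defined_limit_orthogonal[OF wd lim])
  moreover have "v \<bullet> y = 0" using v[OF y] by (simp add: orthogonal_def)
  ultimately have "v \<bullet> v = 0" by (simp add: c inner_add_left inner_commute[of y])
  then have "v = 0" by simp
  with c y have "c \<in> span (?d ` Lt)" by simp
  then obtain b where "c = (\<Sum>i\<in>Lt. b i *\<^sub>R ?d i)"
    by (rule span_family_sum)
  then show "\<exists>b. \<forall>\<eta>. c \<bullet> \<eta> = (\<Sum>i\<in>Lt. b i * mu A i0 i \<eta>)"
    unfolding sum_mu by blast
qed

end
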